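(* Let $G$ be a finite, simple, connected graph with at least one edge, on vertex set $\{1,\dots,N\}$, and let $\nabla_G=\{\pm(\mathbf e_i-\mathbf e_j)\mid \{i,j\}\in\mathcal E(G)\}\subset\mathbb R^N$. Let $F\subseteq\nabla_G$ be a subset of codimension 1 (i.e. $\dim\operatorname{conv}(F)=\dim\operatorname{conv}(\nabla_G)-1=N-2$) such that $\mathbf 0\notin\operatorname{conv}(F)$. If for every cycle $O$ in $G$ and every coherent orientation $\vec O$ of it $$|\mathcal E(\vec G_F)\cap\mathcal E(\vec O)|=|\mathcal E(\vec G_F)\cap\mathcal E(-\vec O)|,$$ then $F$ is a facet of $\nabla_G$.
   Context: $\mathbf e_1,\dots,\mathbf e_N$ is the standard basis of $\mathbb R^N$. A subset $F\subseteq\nabla_G$ is a facet of $\nabla_G$ if $F=\nabla_G\cap P'$ for a facet $P'$ of the polytope $\operatorname{conv}(\nabla_G)$. $\vec G_F$ is the directed graph with edge set $\{(i,j)\mid \mathbf e_i-\mathbf e_j\in F\}$. A coherent orientation $\vec O$ of a cycle $O$ directs its edges so that no vertex is the tail of two edges or the head of two edges; $-\vec O$ reverses all its edges. $\mathcal E(\vec G_F)\cap\mathcal E(\vec O)$ is the set of directed edges of $\vec G_F$ lying on $O$ with the direction of $\vec O$. *)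

theory Defs
  imports "HOL-Analysis.Analysis"
begin

text \<open>
  The vertex set \<open>{1, \<dots>, N}\<close> is the index type \<^typ>\<open>'n::finite\<close> with \<open>N = CARD('n)\<close>, so that
  \<open>real ^ 'n\<close> is the ambient space and \<open>axis i 1\<close> is the standard basis vector \<open>e_i\<close>.
  A graph on all of these vertices is given by its set of undirected edges \<open>{i, j}\<close>.
\<close>

definition simple_graph :: "'n::finite set set \<Rightarrow> bool" where
  "simple_graph E \<longleftrightarrow> (\<forall>e\<in>E. card e = 2)"

definition connected_graph :: "'n::finite set set \<Rightarrow> bool" where
  "connected_graph E \<longleftrightarrow> (\<forall>u v. (u, v) \<in> {(i, j). {i, j} \<in> E}\<^sup>*)"

definition nabla :: "'n::finite set set \<Rightarrow> (real ^ 'n) set" where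
  "nabla E = {x. \<exists>i j. {i, j} \<in> E \<and> (x = axis i 1 - axis j 1 \<or> x = - (axis i 1 - axis j 1))}"

definition facet_subset :: "(real ^ 'n::finite) set \<Rightarrow> (real ^ 'n) set \<Rightarrow> bool" where
  "facet_subset F X \<longleftrightarrow> (\<exists>P'. P' facet_of (convex hull X) \<and> F = X \<inter> P')"

definition digraph_of :: "(real ^ 'n::finite) set \<Rightarrow> ('n \<times> 'n) set" where
  "digraph_of F = {(i, j). axis i 1 - axis j 1 \<in> F}"

text \<open>A cycle is identified with its set of edges.\<close>

definition cycle_in :: "'n::finite set set \<Rightarrow> 'n set set \<Rightarrow> bool" where
  "cycle_in E C \<longleftrightarrow> C \<subseteq> E \<and>
     (\<exists>vs. distinct vs \<and> length vs \<ge> 3 \<and>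
           C = {{vs ! k, vs ! (Suc k mod length vs)} | k. k < length vs})"

definition orientation :: "'n::finite set set \<Rightarrow> ('n \<times> 'n) set \<Rightarrow> bool" where
  "orientation C D \<longleftrightarrow>
     (\<forall>(i, j)\<in>D. {i, j} \<in> C) \<and> (\<forall>e\<in>C. \<exists>!d. d \<in> D \<and> {fst d, snd d} = e)"

text \<open>Edges \<open>(i, j)\<close> have tail \<open>i\<close> and head \<open>j\<close>; the reversed orientation is the converse relation.\<close>

definition coherent_orientation :: "'n::finite set set \<Rightarrow> ('n \<times> 'n) set \<Rightarrow> bool" where
  "coherent_orientation C D \<longleftrightarrow> orientation C D \<and>
     (\<forall>i j k. (i, j) \<in> D \<and> (i, k) \<in> D \<longrightarrow> j = k) \<and>
     (\<forall>i j k. (j, i) \<in> D \<and> (k, i) \<in> D \<longrightarrow> j = k)"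

end

theory Submission
  imports Defs
begin

text \<open>
  Let \<open>w (i, j)\<close> be \<open>1\<close>, \<open>-1\<close> or \<open>0\<close> according to whether the edge \<open>{i, j}\<close> of the graph lies in
  the digraph of \<open>F\<close> as \<open>(i, j)\<close>, as \<open>(j, i)\<close>, or not at all. The hypothesis on cycles says that \<open>w\<close>
  sums to zero around every cycle, hence around every closed walk, so \<open>w\<close> is the
  coboundary of a potential \<open>h\<close> on the vertices. Read as a linear functional, \<open>h\<close> takes the values
  \<open>w\<close> on \<open>\<nabla>\<close>; its supporting hyperplane \<open>h = 1\<close> meets \<open>\<nabla>\<close> exactly in \<open>F\<close>, and the dimension
  hypothesis makes the corresponding face a facet.
\<close>

section \<open>Sums along walks, and potentials\<close>

fun walk_sum :: "('a \<Rightarrow> 'a \<Rightarrow> 'b::comm_monoid_add) \<Rightarrow> 'a list \<Rightarrow> 'b" where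
  "walk_sum w (x # y # zs) = w x y + walk_sum w (y # zs)"
| "walk_sum w _ = 0"

lemma walk_sum_append:
  "walk_sum w (xs @ y # ys) = walk_sum w (xs @ [y]) + walk_sum w (y # ys)"
proof (induction xs)
  case (Cons x xs)
  then show ?case by (cases xs) (auto simp: add.assoc)
qed simp

lemma walk_sum_conv_sum:
  "walk_sum w vs = (\<Sum>k<length vs - 1. w (vs ! k) (vs ! Suc k))"
proof (induction w vs rule: walk_sum.induct)
  case (1 w x y zs)
  then show ?case by (simp add: sum.lessThan_Suc_shift del: sum.lessThan_Suc)
qed simp_all

text \<open>A vertex visited twice cuts a closed walk into two shorter closed walks, so induction on
  the length reduces to walks whose only repetition is the return to the start. These include the
  degenerate ones with one or two vertices, which are not cycles of a graph.\<close>

lemma closed_walk_sum_eq_0: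
  assumes cycle: "\<And>us. distinct us \<Longrightarrow> us \<noteq> [] \<Longrightarrow> successively R (us @ [hd us]) \<Longrightarrow>
      walk_sum w (us @ [hd us]) = 0"
    and "successively R vs" "vs \<noteq> []" "hd vs = last vs"
  shows "walk_sum w vs = 0"
  using assms(2-)
proof (induction vs rule: length_induct)
  case (1 vs)
  define us where "us = butlast vs"
  have vs: "vs = us @ [last vs]"
    using 1 by (simp add: us_def)
  show ?case
  proof (cases "us = []")
    case True
    with vs show ?thesis by (metis append_Nil walk_sum.simps(3))
  next
    case False
    with vs 1 have vs': "vs = us @ [hd us]"
      by (metis hd_append2)
    show ?thesis
    proof (cases "distinct us")
      case True
      with cycle False vs' 1 show ?thesis by metis
    next
      case nd: False
      then obtain xs y ys zs where us: "us = xs @ [y] @ ys @ [y] @ zs"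
        using not_distinct_decomp by blast
      define v where "v = hd us"
      have vs2: "vs = xs @ y # ys @ y # zs @ [v]"
        using vs' us v_def by simp
      \<comment> \<open>Removing the loop \<open>y # ys @ [y]\<close> keeps the starting vertex; for
        \<open>xs = []\<close> that vertex is \<open>y\<close> itself.\<close>
      have hdv: "hd (xs @ [y]) = v"
        using us v_def by (cases xs) auto
      have "successively R (y # ys @ [y])" "successively R (xs @ y # zs @ [v])"
        using 1(2) unfolding vs2
        by (auto simp: successively_append_iff successively_Cons hd_append)
      moreover have "hd (xs @ y # zs @ [v]) = v"
        using hdv by (cases xs) auto
      ultimately have "walk_sum w (y # ys @ [y]) = 0" "walk_sum w (xs @ y # zs @ [v]) = 0"
        using 1(1) vs2 by auto
      moreover have "walk_sum w vs = walk_sum w (xs @ [y]) + (walk_sum w (y # ys @ [y])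
          + walk_sum w (y # zs @ [v]))"
        unfolding vs2
        by (subst walk_sum_append) (metis append_Cons walk_sum_append)
      moreover have "walk_sum w (xs @ y # zs @ [v]) = walk_sum w (xs @ [y]) + walk_sum w (y # zs @ [v])"
        by (rule walk_sum_append)
      ultimately show ?thesis by simp
    qed
  qed
qed

lemma rtrancl_imp_walk:
  assumes "(u, v) \<in> {(i, j). R i j}\<^sup>*"
  obtains vs where "successively R vs" "vs \<noteq> []" "hd vs = u" "last vs = v"
proof -
  from assms have "\<exists>vs. successively R vs \<and> vs \<noteq> [] \<and> hd vs = u \<and> last vs = v"
  proof (induction rule: converse_rtrancl_induct)
    case base
    show ?case by (rule exI[of _ "[v]"]) simp
  next
    case (step x y)
    then obtain vs where "successively R vs" "vs \<noteq> []" "hd vs = y" "last vs = v"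
      by blast
    with step(1) show ?case
      by (intro exI[of _ "x # vs"]) (auto simp: successively_Cons)
  qed
  with that show thesis by blast
qed

text \<open>Fix a root \<open>r\<close> and let \<open>h i\<close> be the sum along a chosen walk
  \<open>p i\<close> from \<open>i\<close> to \<open>r\<close>. The edge from \<open>i\<close> to
  \<open>j\<close> followed by \<open>p j\<close> differs from \<open>p i\<close> only by closed
  walks.\<close>

lemma exists_potential:
  fixes w :: "'a \<Rightarrow> 'a \<Rightarrow> 'b::ab_group_add"
  assumes conn: "\<And>u v. (u, v) \<in> {(i, j). R i j}\<^sup>*"
    and closed: "\<And>vs. successively R vs \<Longrightarrow> vs \<noteq> [] \<Longrightarrow> hd vs = last vs \<Longrightarrow> walk_sum w vs = 0"
  obtains h where "\<And>i j. R i j \<Longrightarrow> w i j = h i - h j"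
proof -
  fix r :: 'a
  have "\<forall>i. \<exists>p. successively R p \<and> p \<noteq> [] \<and> hd p = i \<and> last p = r"
    using rtrancl_imp_walk[OF conn] by metis
  then obtain p where p: "\<And>i. successively R (p i)" "\<And>i. p i \<noteq> []"
      "\<And>i. hd (p i) = i" "\<And>i. last (p i) = r"
    by metis
  \<comment> \<open>The return walk to \<open>i\<close> is stored without its first vertex
    \<open>r\<close>, which is already the last vertex of \<open>p j\<close>.\<close>
  have "\<forall>i. \<exists>q. successively R (r # q) \<and> last (r # q) = i"
  proof
    fix i
    obtain vs where vs: "successively R vs" "vs \<noteq> []" "hd vs = r" "last vs = i"
      using rtrancl_imp_walk[OF conn[of r i]] .
    then have "vs = r # tl vs" by (metis list.collapse)
    with vs show "\<exists>q. successively R (r # q) \<and> last (r # q) = i" by metis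
  qed
  then obtain q where q: "\<And>i. successively R (r # q i)" "\<And>i. last (r # q i) = i"
    by metis
  have p_split: "p i = butlast (p i) @ [r]" for i
    using p by (metis append_butlast_last_id)
  have walk: "successively R (p j @ q i)" for i j
  proof -
    have "successively R (butlast (p j) @ r # q i)"
      using p(1)[of j] q(1)[of i] p_split[of j]
      by (metis append_is_Nil_conv list.sel(1) not_Cons_self2 successively_append_iff)
    then show ?thesis using p_split[of j] by (metis append.assoc append_Cons append_Nil)
  qed
  have last: "last (p j @ q i) = i" for i j
    using p(4)[of j] q(2)[of i] by (auto split: if_splits)
  have sum: "walk_sum w (p j @ q i) = walk_sum w (p j) + walk_sum w (r # q i)" for i j
    using walk_sum_append[of w "butlast (p j)" r "q i"] p_split[of j]
    by (metis append.assoc append_Cons append_Nil)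
  have "w i j = walk_sum w (p i) - walk_sum w (p j)" if "R i j" for i j
  proof -
    have "walk_sum w (p i @ q i) = 0"
      using closed walk last p by (metis append_is_Nil_conv hd_append2)
    \<comment> \<open>Both walks from \<open>i\<close> to \<open>r\<close> can be closed by the same
      return walk, so \<open>w\<close> need not be antisymmetric.\<close>
    then have loop: "walk_sum w (r # q i) = - walk_sum w (p i)"
      unfolding sum by (simp add: eq_neg_iff_add_eq_0 add.commute)
    have "successively R (i # p j @ q i)"
      using that walk p by (auto simp: successively_Cons)
    moreover have "last (i # p j @ q i) = i"
      using last p by simp
    ultimately have "walk_sum w (i # p j @ q i) = 0"
      using closed by (metis list.sel(1) list.distinct(1))
    moreover have "walk_sum w (i # p j @ q i) = w i j + walk_sum w (p j @ q i)"
      using p(2,3)[of j] by (cases "p j") auto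
    ultimately have "w i j + (walk_sum w (p j) - walk_sum w (p i)) = 0"
      unfolding sum loop by simp
    then show ?thesis
      by (metis add_eq_0_iff minus_diff_eq minus_minus)
  qed
  then show thesis by (rule that)
qed

section \<open>Cycles and their coherent orientations\<close>

lemma Suc_mod_eq_if: "Suc k mod n = (if Suc k = n then 0 else Suc k)" if "k < n"
  using that by (cases "Suc k = n") simp_all

lemma Suc_mod_inj:
  assumes "k < n" "m < n" "Suc k mod n = Suc m mod n"
  shows "k = m"
  using assms(3) unfolding Suc_mod_eq_if[OF assms(1)] Suc_mod_eq_if[OF assms(2)]
  by (simp split: if_splits)

text \<open>Traversing the vertex list cyclically orients each edge once. Length at least 3 matters:
  with two vertices the same edge would be traversed in both directions.\<close>

lemma coherent_orientation_cycle:
  fixes us :: "'n::finite list"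
  assumes dist: "distinct us" and len: "length us \<ge> 3"
  defines "n \<equiv> length us"
  shows "coherent_orientation {{us ! k, us ! (Suc k mod n)} | k. k < n}
           ((\<lambda>k. (us ! k, us ! (Suc k mod n))) ` {..<n})"
proof -
  have n: "n \<ge> 3" using len n_def by simp
  have lt: "Suc k mod n < n" for k
    using n by simp
  have nth: "us ! k = us ! m \<longleftrightarrow> k = m" if "k < n" "m < n" for k m
    using that dist n_def by (simp add: nth_eq_iff_index_eq)
  have uniq: "k = m" if "k < n" "m < n"
    "{us ! m, us ! (Suc m mod n)} = {us ! k, us ! (Suc k mod n)}" for k m
  proof (rule ccontr)
    assume "k \<noteq> m"
    \<comment> \<open>Equal edges at different positions must be traversed in opposite directions,
      so each position is the cyclic successor of the other, impossible for
      \<open>n \<ge> 3\<close>.\<close>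
    with that have "m = Suc k mod n" "k = Suc m mod n"
      using nth lt by (metis doubleton_eq_iff)+
    then show False
      unfolding Suc_mod_eq_if[OF that(1)] Suc_mod_eq_if[OF that(2)]
      using n by presburger
  qed
  have "orientation {{us ! k, us ! (Suc k mod n)} | k. k < n}
           ((\<lambda>k. (us ! k, us ! (Suc k mod n))) ` {..<n})"
    unfolding orientation_def
  proof (intro conjI ballI)
    fix e assume "e \<in> {{us ! k, us ! (Suc k mod n)} | k. k < n}"
    then obtain k where k: "k < n" "e = {us ! k, us ! (Suc k mod n)}" by blast
    show "\<exists>!d. d \<in> (\<lambda>k. (us ! k, us ! (Suc k mod n))) ` {..<n} \<and> {fst d, snd d} = e"
    proof (rule ex1I[of _ "(us ! k, us ! (Suc k mod n))"])
      show "d = (us ! k, us ! (Suc k mod n))"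
        if "d \<in> (\<lambda>k. (us ! k, us ! (Suc k mod n))) ` {..<n} \<and> {fst d, snd d} = e" for d
      proof -
        from that obtain m where "m < n" "d = (us ! m, us ! (Suc m mod n))" "{fst d, snd d} = e"
          by blast
        moreover from this have "k = m" using k by (intro uniq) simp_all
        ultimately show ?thesis by simp
      qed
    qed (use k in auto)
  qed auto
  moreover have "\<forall>i j k. (i, j) \<in> (\<lambda>k. (us ! k, us ! (Suc k mod n))) ` {..<n}
      \<and> (i, k) \<in> (\<lambda>k. (us ! k, us ! (Suc k mod n))) ` {..<n} \<longrightarrow> j = k"
    using nth by auto
  moreover have "\<forall>i j k. (j, i) \<in> (\<lambda>k. (us ! k, us ! (Suc k mod n))) ` {..<n}
      \<and> (k, i) \<in> (\<lambda>k. (us ! k, us ! (Suc k mod n))) ` {..<n} \<longrightarrow> j = k"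
    using nth lt by (auto dest: Suc_mod_inj)
  ultimately show ?thesis
    unfolding coherent_orientation_def by blast
qed

definition signed_indicator :: "('a \<times> 'a) set \<Rightarrow> 'a \<Rightarrow> 'a \<Rightarrow> real" where
  "signed_indicator A i j = of_bool ((i, j) \<in> A) - of_bool ((j, i) \<in> A)"

text \<open>Splitting the signed indicator into its two terms turns the sum into the number of edges
  of \<open>A\<close> along the traversal minus the number against it, and \<open>bal\<close>
  equates the two.\<close>

lemma cycle_sum_eq_0:
  fixes us :: "'n::finite list"
  assumes bal: "\<And>C D. cycle_in E C \<Longrightarrow> coherent_orientation C D \<Longrightarrow>
           card (A \<inter> D) = card (A \<inter> D\<inverse>)"
    and dist: "distinct us" and ne: "us \<noteq> []"
    and walk: "successively (\<lambda>i j. {i, j} \<in> E) (us @ [hd us])"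
  shows "walk_sum (signed_indicator A) (us @ [hd us]) = 0"
proof (cases "length us \<ge> 3")
  case False
  \<comment> \<open>Here antisymmetry of \<open>signed_indicator\<close> suffices: it vanishes on a
    loop, and going along an edge and back cancels.\<close>
  then consider x where "us = [x]" | x y where "us = [x, y]"
    using ne by (cases us; cases "tl us"; cases "tl (tl us)") auto
  then show ?thesis
    by cases (auto simp: signed_indicator_def)
next
  case True
  define n where "n = length us"
  have n: "n \<ge> 3" using True n_def by simp
  define C where "C = {{us ! k, us ! (Suc k mod n)} | k. k < n}"
  define e where "e k = (us ! k, us ! (Suc k mod n))" for k
  have nth: "(us @ [hd us]) ! k = us ! k" "(us @ [hd us]) ! Suc k = us ! (Suc k mod n)"
    if "k < n" for k
    using that ne by (auto simp: nth_append n_def mod_Suc hd_conv_nth)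
  have "{us ! k, us ! (Suc k mod n)} \<in> E" if "k < n" for k
    using successively_nth[OF walk, of k] that nth n_def by auto
  then have "cycle_in E C"
    unfolding cycle_in_def C_def n_def using dist True by blast
  moreover have "coherent_orientation C (e ` {..<n})"
    unfolding C_def e_def n_def by (rule coherent_orientation_cycle[OF dist True])
  ultimately have card: "card (A \<inter> e ` {..<n}) = card (A \<inter> (e ` {..<n})\<inverse>)"
    by (rule bal)
  have inj: "inj_on e {..<n}"
    using dist by (auto simp: inj_on_def e_def n_def nth_eq_iff_index_eq)
  have count: "(\<Sum>k<n. of_bool (f k \<in> A)) = real (card (A \<inter> f ` {..<n}))"
    if "inj_on f {..<n}" for f
  proof -
    have "(\<Sum>k<n. of_bool (f k \<in> A)) = (\<Sum>d\<in>f ` {..<n}. of_bool (d \<in> A) :: real)"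
      by (subst sum.reindex[OF that]) (simp add: o_def)
    also have "\<dots> = real (card (f ` {..<n} \<inter> A))"
      by (simp add: of_bool_def sum.If_cases)
    finally show ?thesis by (simp add: Int_commute)
  qed
  have "walk_sum (signed_indicator A) (us @ [hd us])
      = (\<Sum>k<n. signed_indicator A (us ! k) (us ! (Suc k mod n)))"
    unfolding walk_sum_conv_sum using nth by (intro sum.cong) (auto simp: n_def)
  also have "\<dots> = (\<Sum>k<n. of_bool (e k \<in> A)) - (\<Sum>k<n. of_bool ((prod.swap \<circ> e) k \<in> A))"
    by (simp add: signed_indicator_def e_def sum_subtractf)
  also have "\<dots> = real (card (A \<inter> e ` {..<n})) - real (card (A \<inter> (prod.swap \<circ> e) ` {..<n}))"
    using inj by (subst (1 2) count) (auto intro!: comp_inj_on)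
  also have "(prod.swap \<circ> e) ` {..<n} = (e ` {..<n})\<inverse>"
    by (auto simp: image_iff e_def)
  finally show ?thesis using card by simp
qed

section \<open>The supporting hyperplane and its face\<close>

theorem mainTheorem5:
  fixes E :: "'n::finite set set" and F :: "(real ^ 'n) set"
  assumes "simple_graph E" and "connected_graph E" and "E \<noteq> {}"
    and "F \<subseteq> nabla E"
    and "aff_dim (convex hull F) = aff_dim (convex hull (nabla E)) - 1"
    and "0 \<notin> convex hull F"
    and "\<And>C D. cycle_in E C \<Longrightarrow> coherent_orientation C D \<Longrightarrow>
           card (digraph_of F \<inter> D) = card (digraph_of F \<inter> D\<inverse>)"
  shows "facet_subset F (nabla E)"
proof -
  let ?w = "signed_indicator (digraph_of F)"
  have closed: "walk_sum ?w vs = 0"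
    if "successively (\<lambda>i j. {i, j} \<in> E) vs" "vs \<noteq> []" "hd vs = last vs" for vs
    by (rule closed_walk_sum_eq_0[OF cycle_sum_eq_0[OF assms(7)] that])
  have conn: "(u, v) \<in> {(i, j). {i, j} \<in> E}\<^sup>*" for u v
    using assms(2) by (simp add: connected_graph_def)
  obtain h where h: "\<And>i j. {i, j} \<in> E \<Longrightarrow> ?w i j = h i - h j"
    using exists_potential[OF conn closed] by blast
  define a :: "real ^ 'n" where "a = (\<chi> i. h i)"
  have inner: "a \<bullet> (axis i 1 - axis j 1) = ?w i j" if "{i, j} \<in> E" for i j
    using h[OF that] by (simp add: a_def inner_diff_right inner_axis)
  have nablaE: "\<exists>i j. {i, j} \<in> E \<and> x = axis i 1 - axis j 1" if "x \<in> nabla E" for x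
    using that unfolding nabla_def by (auto, metis insert_commute)
  \<comment> \<open>The midpoint of \<open>x\<close> and \<open>- x\<close> is the origin. Hence the
    two indicators never cancel, and the value 1 is attained exactly on \<open>F\<close>.\<close>
  have opp: "- x \<notin> F" if "x \<in> F" for x
  proof
    assume "- x \<in> F"
    with that have "(1/2) *\<^sub>R x + (1/2) *\<^sub>R (- x) \<in> convex hull F"
      by (intro convexD[OF convex_convex_hull]) (auto intro: hull_inc)
    with assms(6) show False by simp
  qed
  have le: "a \<bullet> x \<le> 1" and eq: "a \<bullet> x = 1 \<longleftrightarrow> x \<in> F" if "x \<in> nabla E" for x
  proof -
    obtain i j where ij: "{i, j} \<in> E" "x = axis i 1 - axis j 1"
      using nablaE[OF \<open>x \<in> nabla E\<close>] by blast
    have "a \<bullet> x = of_bool (x \<in> F) - of_bool (- x \<in> F)"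
      using inner[OF ij(1)] ij(2) by (simp add: signed_indicator_def digraph_of_def)
    with opp show "a \<bullet> x \<le> 1" "a \<bullet> x = 1 \<longleftrightarrow> x \<in> F" by auto
  qed
  let ?S = "convex hull (nabla E)"
  define P where "P = ?S \<inter> {x. a \<bullet> x = 1}"
  have "?S \<subseteq> {x. a \<bullet> x \<le> 1}"
    using le by (intro hull_minimal convex_halfspace_le) auto
  then have face: "P face_of ?S"
    unfolding P_def by (intro face_of_Int_supporting_hyperplane_le) auto
  obtain i j where ij: "{i, j} \<in> E" "i \<noteq> j"
    using assms(1,3) unfolding simple_graph_def by (metis card_2_iff ex_in_conv)
  define x :: "real ^ 'n" where "x = axis i 1 - axis j 1"
  have x: "x \<in> nabla E" "- x \<in> nabla E"
    using ij unfolding nabla_def x_def by blast+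
  have "x \<noteq> 0" using ij by (auto simp: x_def axis_eq_axis)
  \<comment> \<open>A linear functional cannot equal 1 at both \<open>x\<close> and
    \<open>- x\<close>, so the face is proper and its dimension drops; containing \<open>F\<close>,
    it drops by exactly one.\<close>
  have "P \<noteq> ?S"
  proof
    assume "P = ?S"
    then have "a \<bullet> x = 1" "a \<bullet> (- x) = 1"
      using x unfolding P_def by (blast intro: hull_inc)+
    then show False by simp
  qed
  then have "aff_dim P < aff_dim ?S"
    using face by (simp add: face_of_aff_dim_lt)
  moreover have FP: "F = nabla E \<inter> P"
    using eq assms(4) by (auto simp: P_def hull_inc)
  then have "aff_dim ?S - 1 \<le> aff_dim P"
    using assms(5) aff_dim_subset[of F P] by (simp add: aff_dim_convex_hull)
  \<comment> \<open>The empty set has affine dimension -1, so an empty \<open>F\<close> would make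
    \<open>nabla E\<close> a single point, although it contains the distinct points \<open>x\<close>
    and \<open>- x\<close>.\<close>
  moreover have "F \<noteq> {}"
  proof
    assume "F = {}"
    with assms(5) have "aff_dim (nabla E) = 0"
      by (simp add: aff_dim_convex_hull)
    then have "x = - x"
      using x by (auto simp: aff_dim_eq_0)
    then have "2 *\<^sub>R x = 0"
      by (simp only: scaleR_2 eq_neg_iff_add_eq_0)
    with \<open>x \<noteq> 0\<close> show False by simp
  qed
  ultimately have "P facet_of ?S"
    using face FP unfolding facet_of_def by auto
  with FP show ?thesis
    unfolding facet_subset_def by blast
qed

end
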